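(* Let $E$ and $F$ be Banach lattices and let $S, T: E \to F$ be positive operators such that $S \leq T$ and $T$ is an almost limited completely continuous operator. If $E$ has property (d) and the lattice operations in $E$ are weakly sequentially continuous, then $S$ is an almost limited completely continuous operator.
   Context: All Banach spaces and Banach lattices are real; operators are linear. $E'$ denotes the topological dual of $E$, a Banach lattice with the dual order. A sequence $(f_n)$ in a Banach lattice is disjoint if $|f_n| \wedge |f_m| = 0$ for $n \neq m$. A Banach lattice $E$ has property (d) if $|f_n| \to 0$ in the weak* topology for every disjoint weak* null sequence $(f_n) \subset E'$. A bounded set $A \subset E$ is almost limited if every disjoint weak* null sequence $(f_n)$ in $E'$ converges uniformly to zero on $A$, i.e. $\sup_{x \in A} |f_n(x)| \to 0$. A sequence $(x_n)$ in $E$ is almost limited if the set $\{x_n : n \in \mathbb{N}\}$ is almost limited. A bounded linear operator $T: E \to Y$ into a Banach space $Y$ is almost limited completely continuous (alcc) if $\|Tx_n\| \to 0$ for every almost limited weakly null sequence $(x_n) \subset E$. The lattice operations in $E$ are weakly sequentially continuous if $x_n \to 0$ weakly in $E$ implies $|x_n| \to 0$ weakly in $E$. $S \le T$ means that $T - S$ is a positive operator. *)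

theory Defs
  imports "HOL-Analysis.Analysis" "HOL-Library.Lattice_Algebras"
begin

section \<open>Banach lattices\<close>

class banach_lattice = banach + ordered_real_vector + lattice_ab_group_add_abs +
  assumes norm_mono_abs: "\<bar>x\<bar> \<le> \<bar>y\<bar> \<Longrightarrow> norm x \<le> norm y"

instance real :: banach_lattice
proof
  fix x y :: real
  show "\<bar>x\<bar> \<le> \<bar>y\<bar> \<Longrightarrow> norm x \<le> norm y"
    by simp
qed

section \<open>The dual lattice\<close>

text \<open>
  The topological dual of \<open>E\<close> is the type of bounded linear functionals on \<open>E\<close>.  It carries
  no order in the library.  Its order is that of the dual cone, and suprema and infima are the
  order-theoretic ones; they exist by the Riesz--Kantorovich theorem, see the interpretation
  \<open>dual_lattice\<close> below.
\<close>

type_synonym 'a dual = "'a \<Rightarrow>\<^sub>L real"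

definition dual_le :: "'a::banach_lattice dual \<Rightarrow> 'a dual \<Rightarrow> bool" where
  "dual_le f g \<longleftrightarrow> (\<forall>x\<ge>0. blinfun_apply f x \<le> blinfun_apply g x)"

definition is_dual_sup :: "'a::banach_lattice dual \<Rightarrow> 'a dual \<Rightarrow> 'a dual \<Rightarrow> bool" where
  "is_dual_sup f g h \<longleftrightarrow>
     dual_le f h \<and> dual_le g h \<and> (\<forall>k. dual_le f k \<and> dual_le g k \<longrightarrow> dual_le h k)"

definition is_dual_inf :: "'a::banach_lattice dual \<Rightarrow> 'a dual \<Rightarrow> 'a dual \<Rightarrow> bool" where
  "is_dual_inf f g h \<longleftrightarrow>
     dual_le h f \<and> dual_le h g \<and> (\<forall>k. dual_le k f \<and> dual_le k g \<longrightarrow> dual_le k h)"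

definition dual_sup :: "'a::banach_lattice dual \<Rightarrow> 'a dual \<Rightarrow> 'a dual" where
  "dual_sup f g = (THE h. is_dual_sup f g h)"

definition dual_inf :: "'a::banach_lattice dual \<Rightarrow> 'a dual \<Rightarrow> 'a dual" where
  "dual_inf f g = (THE h. is_dual_inf f g h)"

definition dual_abs :: "'a::banach_lattice dual \<Rightarrow> 'a dual" where
  "dual_abs f = dual_sup f (- f)"

lemma dual_le_antisym:
  fixes f g :: "'a::banach_lattice dual"
  assumes "dual_le f g" "dual_le g f"
  shows "f = g"
proof (rule blinfun_eqI)
  fix x :: 'a
  have pos: "blinfun_apply f u = blinfun_apply g u" if "0 \<le> u" for u
    using assms that by (meson dual_le_def order_antisym)
  have x: "x = pprt x - pprt (- x)"
    by (metis diff_minus_eq_add pprt_neg prts)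
  show "blinfun_apply f x = blinfun_apply g x"
    by (subst (1 2) x) (simp add: blinfun.diff_right pos)
qed

lemma riesz_decomposition:
  fixes x y z :: "'a::banach_lattice"
  assumes "0 \<le> x" "0 \<le> y" "0 \<le> z" "z \<le> x + y"
  obtains u v where "z = u + v" "0 \<le> u" "u \<le> x" "0 \<le> v" "v \<le> y"
proof
  show "z = inf z x + (z - inf z x)"
    by (metis add.commute diff_add_cancel)
  show "0 \<le> inf z x" "inf z x \<le> x"
    using assms by auto
  show "0 \<le> z - inf z x"
    unfolding le_diff_eq by simp
  have "z - y \<le> inf z x"
    using assms by (simp add: diff_le_eq)
  then show "z - inf z x \<le> y"
    by (metis diff_le_eq add.commute)
qed

lemma dual_pos_part_exists:
  fixes f :: "'a::banach_lattice dual"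
  shows "\<exists>g. is_dual_sup f 0 g"
proof -
  define p where "p x = (SUP y\<in>{0..x}. blinfun_apply f y)" for x
  define g where "g x = p (pprt x) - p (pprt (- x))" for x
  have bd: "\<bar>blinfun_apply f y\<bar> \<le> norm f * norm x" if "y \<in> {0..x}" for x y
  proof -
    have "\<bar>y\<bar> \<le> \<bar>x\<bar>"
      using that by (metis abs_of_nonneg atLeastAtMost_iff order_trans)
    then have "norm y \<le> norm x"
      by (rule norm_mono_abs)
    then show ?thesis
      using norm_blinfun[of f y] mult_left_mono[of "norm y" "norm x" "norm f"] by simp
  qed
  have bdd: "bdd_above (blinfun_apply f ` {0..x})" for x
    using bd by (intro bdd_aboveI2[where M = "norm f * norm x"]) (meson abs_le_D1)
  have upper: "blinfun_apply f y \<le> p x" if "0 \<le> y" "y \<le> x" for x y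
    unfolding p_def using that by (intro cSUP_upper bdd) auto
  have least: "p x \<le> c" if "0 \<le> x" "\<And>y. 0 \<le> y \<Longrightarrow> y \<le> x \<Longrightarrow> blinfun_apply f y \<le> c" for x c
    unfolding p_def using that by (intro cSUP_least) auto
  have p_nonneg: "0 \<le> p x" if "0 \<le> x" for x
    using upper[of 0 x] that by simp
  have p_bound: "p x \<le> norm f * norm x" if "0 \<le> x" for x
    using that bd by (intro least) (auto dest: abs_le_D1)
  have p_add: "p (x + y) = p x + p y" if xy: "0 \<le> x" "0 \<le> y" for x y
  proof (rule order_antisym)
    show "p (x + y) \<le> p x + p y"
    proof (rule least)
      fix z assume "0 \<le> z" "z \<le> x + y"
      then obtain u v where "z = u + v" "0 \<le> u" "u \<le> x" "0 \<le> v" "v \<le> y"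
        using riesz_decomposition xy by metis
      then show "blinfun_apply f z \<le> p x + p y"
        by (simp add: blinfun.add_right add_mono upper)
    qed (use xy in simp)
    have "p x \<le> p (x + y) - p y"
    proof (rule least[OF xy(1)])
      fix u assume u: "0 \<le> u" "u \<le> x"
      have "p y \<le> p (x + y) - blinfun_apply f u"
      proof (rule least[OF xy(2)])
        fix v assume "0 \<le> v" "v \<le> y"
        then have "blinfun_apply f (u + v) \<le> p (x + y)"
          using u by (intro upper add_mono) auto
        then show "blinfun_apply f v \<le> p (x + y) - blinfun_apply f u"
          by (simp add: blinfun.add_right)
      qed
      then show "blinfun_apply f u \<le> p (x + y) - p y"
        by simp
    qed
    then show "p x + p y \<le> p (x + y)"
      by simp
  qed
  have p_scale_le: "c * p x \<le> p (c *\<^sub>R x)" if "0 \<le> x" "0 < c" for c x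
  proof -
    have "p x \<le> p (c *\<^sub>R x) / c"
    proof (rule least[OF that(1)])
      fix y assume "0 \<le> y" "y \<le> x"
      then have "blinfun_apply f (c *\<^sub>R y) \<le> p (c *\<^sub>R x)"
        using that by (intro upper scaleR_left_mono scaleR_nonneg_nonneg) auto
      then show "blinfun_apply f y \<le> p (c *\<^sub>R x) / c"
        using that by (simp add: blinfun.scaleR_right field_simps)
    qed
    then show ?thesis
      using that by (simp add: field_simps)
  qed
  have p0: "p 0 = 0"
    using p_add[of 0 0] by simp
  have p_scale: "p (c *\<^sub>R x) = c * p x" if "0 \<le> x" "0 \<le> c" for c x
  proof (cases "c = 0")
    case False
    then have c: "0 < c"
      using that by simp
    have "inverse c * p (c *\<^sub>R x) \<le> p (inverse c *\<^sub>R c *\<^sub>R x)"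
      using c that by (intro p_scale_le scaleR_nonneg_nonneg) auto
    then have "p (c *\<^sub>R x) \<le> c * p x"
      using c by (simp add: field_simps)
    then show ?thesis
      using p_scale_le[OF that(1) c] by simp
  qed (simp add: p0)
  have dec: "x = pprt x - pprt (- x)" for x :: 'a
    by (metis diff_minus_eq_add pprt_neg prts)
  have g_eq: "g (u - v) = p u - p v" if "0 \<le> u" "0 \<le> v" for u v
  proof -
    have "u + pprt (- (u - v)) = pprt (u - v) + v"
      using dec[of "u - v"] by (metis add_diff_cancel_right' add_diff_eq diff_add_eq diff_eq_eq)
    then have "p u + p (pprt (- (u - v))) = p (pprt (u - v)) + p v"
      using p_add that zero_le_pprt by metis
    then show ?thesis
      by (simp add: g_def)
  qed
  have g_pos: "g x = p x" if "0 \<le> x" for x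
    using g_eq[of x 0] that p0 by simp
  have g_add: "g (x + y) = g x + g y" for x y
  proof -
    have "x + y = (pprt x + pprt y) - (pprt (- x) + pprt (- y))"
      using dec[of x] dec[of y] by (metis add_diff_add)
    then have "g (x + y) = p (pprt x + pprt y) - p (pprt (- x) + pprt (- y))"
      using g_eq by (metis add_nonneg_nonneg zero_le_pprt)
    then show ?thesis
      by (simp add: p_add g_def)
  qed
  have g_scale: "g (c *\<^sub>R x) = c * g x" for c x
  proof (cases "0 \<le> c")
    case True
    have "c *\<^sub>R x = c *\<^sub>R pprt x - c *\<^sub>R pprt (- x)"
      using dec[of x] by (metis scaleR_diff_right)
    then have "g (c *\<^sub>R x) = p (c *\<^sub>R pprt x) - p (c *\<^sub>R pprt (- x))"
      using g_eq True by (metis scaleR_nonneg_nonneg zero_le_pprt)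
    then show ?thesis
      using True by (simp add: p_scale g_def right_diff_distrib)
  next
    case False
    then have c: "0 \<le> - c"
      by simp
    have "c *\<^sub>R x = c *\<^sub>R (pprt x - pprt (- x))"
      using dec[of x] by simp
    also have "\<dots> = (- c) *\<^sub>R pprt (- x) - (- c) *\<^sub>R pprt x"
      by (simp add: scaleR_diff_right)
    finally have "g (c *\<^sub>R x) = p ((- c) *\<^sub>R pprt (- x)) - p ((- c) *\<^sub>R pprt x)"
      using g_eq c by (metis scaleR_nonneg_nonneg zero_le_pprt)
    then show ?thesis
      unfolding p_scale[OF zero_le_pprt c] by (simp add: g_def algebra_simps)
  qed
  have pprt_norm: "norm (pprt x) \<le> norm x" for x :: 'a
  proof (rule norm_mono_abs)
    have "pprt x \<le> \<bar>x\<bar>"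
      unfolding pprt_def by (intro le_supI abs_ge_self abs_ge_zero)
    then show "\<bar>pprt x\<bar> \<le> \<bar>x\<bar>"
      by simp
  qed
  have g_bound: "norm (g x) \<le> norm x * norm f" for x
  proof -
    have "p (pprt y) \<le> norm f * norm y" for y
      by (rule order_trans[OF p_bound[OF zero_le_pprt] mult_left_mono[OF pprt_norm norm_ge_zero]])
    from this[of x] this[of "- x"]
    have "p (pprt x) \<le> norm f * norm x" "p (pprt (- x)) \<le> norm f * norm x"
      by simp_all
    moreover have "0 \<le> p (pprt x)" "0 \<le> p (pprt (- x))"
      by (auto intro: p_nonneg)
    ultimately show ?thesis
      by (simp add: g_def mult.commute abs_le_iff)
  qed
  have g_lin: "bounded_linear g"
    by (rule bounded_linear_intro[where K = "norm f", OF g_add _ g_bound]) (simp add: g_scale)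
  have "is_dual_sup f 0 (Blinfun g)"
    unfolding is_dual_sup_def dual_le_def bounded_linear_Blinfun_apply[OF g_lin]
  proof (intro conjI allI impI)
    fix x :: 'a assume x: "0 \<le> x"
    show "blinfun_apply f x \<le> g x" "blinfun_apply 0 x \<le> g x"
      using x by (simp_all add: g_pos upper p_nonneg)
  next
    fix k :: "'a dual" and x :: 'a
    assume k: "(\<forall>x\<ge>0. blinfun_apply f x \<le> blinfun_apply k x) \<and>
      (\<forall>x\<ge>0. blinfun_apply 0 x \<le> blinfun_apply k x)" and x: "0 \<le> x"
    have "p x \<le> blinfun_apply k x"
    proof (rule least[OF x])
      fix y assume y: "0 \<le> y" "y \<le> x"
      have "0 \<le> blinfun_apply k (x - y)"
        using k y by simp
      then have "blinfun_apply k y \<le> blinfun_apply k x"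
        by (simp add: blinfun.diff_right)
      moreover have "blinfun_apply f y \<le> blinfun_apply k y"
        using k y by blast
      ultimately show "blinfun_apply f y \<le> blinfun_apply k x"
        by (rule order_trans[rotated])
    qed
    then show "g x \<le> blinfun_apply k x"
      using x by (simp add: g_pos)
  qed
  then show ?thesis ..
qed

lemma is_dual_sup_exists: "\<exists>h. is_dual_sup f g h"
proof -
  obtain h where h: "is_dual_sup (f - g) 0 h"
    using dual_pos_part_exists by blast
  have shift: "dual_le (k - g) l \<longleftrightarrow> dual_le k (l + g)" for k l
    by (simp add: dual_le_def blinfun.diff_left blinfun.add_left algebra_simps)
  have zero: "dual_le 0 l \<longleftrightarrow> dual_le g (l + g)" for l
    by (simp add: dual_le_def blinfun.add_left)
  have "dual_le (h + g) k" if "dual_le f k" "dual_le g k" for k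
  proof -
    have "dual_le h (k - g)"
      using h that shift[of f "k - g"] zero[of "k - g"] by (simp add: is_dual_sup_def)
    then show ?thesis
      by (simp add: dual_le_def blinfun.diff_left blinfun.add_left algebra_simps)
  qed
  then have "is_dual_sup f g (h + g)"
    using h shift zero by (simp add: is_dual_sup_def)
  then show ?thesis ..
qed

lemma is_dual_inf_exists: "\<exists>h. is_dual_inf f g h"
proof -
  obtain h where h: "is_dual_sup (- f) (- g) h"
    using is_dual_sup_exists by blast
  have neg: "dual_le (- k) l \<longleftrightarrow> dual_le (- l) k" for k l :: "'a dual"
    by (auto simp: dual_le_def blinfun.minus_left minus_le_iff)
  have neg2: "dual_le (- k) (- l) \<longleftrightarrow> dual_le l k" for k l :: "'a dual"
    by (auto simp: dual_le_def blinfun.minus_left)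
  have "is_dual_inf f g (- h)"
    using h neg neg2 unfolding is_dual_sup_def is_dual_inf_def by (metis add.inverse_inverse)
  then show ?thesis ..
qed

lemma dual_sup: "is_dual_sup f g (dual_sup f g)"
proof -
  have "\<exists>!h. is_dual_sup f g h"
  proof (rule ex_ex1I[OF is_dual_sup_exists])
    show "h = k" if "is_dual_sup f g h" "is_dual_sup f g k" for h k
      using that by (auto simp: is_dual_sup_def intro: dual_le_antisym)
  qed
  then show ?thesis
    unfolding dual_sup_def by (rule theI')
qed

lemma dual_inf: "is_dual_inf f g (dual_inf f g)"
proof -
  have "\<exists>!h. is_dual_inf f g h"
  proof (rule ex_ex1I[OF is_dual_inf_exists])
    show "h = k" if "is_dual_inf f g h" "is_dual_inf f g k" for h k
      using that by (auto simp: is_dual_inf_def intro: dual_le_antisym)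
  qed
  then show ?thesis
    unfolding dual_inf_def by (rule theI')
qed

interpretation dual_lattice:
  lattice dual_inf dual_le "\<lambda>f g. dual_le f g \<and> \<not> dual_le g f" dual_sup
proof
  fix f g h :: "'a dual"
  show "dual_le f f"
    by (simp add: dual_le_def)
  show "dual_le f g \<Longrightarrow> dual_le g h \<Longrightarrow> dual_le f h"
    by (meson dual_le_def order_trans)
  show "dual_le f g \<Longrightarrow> dual_le g f \<Longrightarrow> f = g"
    by (rule dual_le_antisym)
  show "dual_le (dual_inf f g) f" "dual_le (dual_inf f g) g"
    "dual_le f g \<Longrightarrow> dual_le f h \<Longrightarrow> dual_le f (dual_inf g h)"
    using dual_inf[of f g] dual_inf[of g h] by (simp_all add: is_dual_inf_def)
  show "dual_le f (dual_sup f g)" "dual_le g (dual_sup f g)"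
    "dual_le g f \<Longrightarrow> dual_le h f \<Longrightarrow> dual_le (dual_sup g h) f"
    using dual_sup[of f g] dual_sup[of g h] by (simp_all add: is_dual_sup_def)
qed simp

section \<open>Weak and weak* null sequences, almost limited sets and operators\<close>

definition weakly_null :: "(nat \<Rightarrow> 'a::real_normed_vector) \<Rightarrow> bool" where
  "weakly_null x \<longleftrightarrow> (\<forall>f :: 'a dual. (\<lambda>n. blinfun_apply f (x n)) \<longlonglongrightarrow> 0)"

definition weak_star_null :: "(nat \<Rightarrow> 'a::real_normed_vector dual) \<Rightarrow> bool" where
  "weak_star_null f \<longleftrightarrow> (\<forall>x. (\<lambda>n. blinfun_apply (f n) x) \<longlonglongrightarrow> 0)"

definition dual_disjoint_seq :: "(nat \<Rightarrow> 'a::banach_lattice dual) \<Rightarrow> bool" where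
  "dual_disjoint_seq f \<longleftrightarrow> (\<forall>n m. n \<noteq> m \<longrightarrow> dual_inf (dual_abs (f n)) (dual_abs (f m)) = 0)"

definition property_d :: "'a::banach_lattice itself \<Rightarrow> bool" where
  "property_d _ \<longleftrightarrow> (\<forall>f :: nat \<Rightarrow> 'a dual.
     dual_disjoint_seq f \<and> weak_star_null f \<longrightarrow> weak_star_null (\<lambda>n. dual_abs (f n)))"

definition weakly_seq_cont_lattice_ops :: "'a::banach_lattice itself \<Rightarrow> bool" where
  "weakly_seq_cont_lattice_ops _ \<longleftrightarrow> (\<forall>x :: nat \<Rightarrow> 'a.
     weakly_null x \<longrightarrow> weakly_null (\<lambda>n. \<bar>x n\<bar>))"

definition almost_limited :: "'a::banach_lattice set \<Rightarrow> bool" where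
  "almost_limited A \<longleftrightarrow> bounded A \<and> (\<forall>f :: nat \<Rightarrow> 'a dual.
     dual_disjoint_seq f \<and> weak_star_null f \<longrightarrow>
     uniform_limit A (\<lambda>n x. blinfun_apply (f n) x) (\<lambda>x. 0) sequentially)"

definition alcc :: "('a::banach_lattice \<Rightarrow> 'b::banach) \<Rightarrow> bool" where
  "alcc T \<longleftrightarrow> bounded_linear T \<and> (\<forall>x :: nat \<Rightarrow> 'a.
     almost_limited (range x) \<and> weakly_null x \<longrightarrow> (\<lambda>n. norm (T (x n))) \<longlonglongrightarrow> 0)"

text \<open>Continuity is not part of positivity; on Banach lattices it is automatic.\<close>

definition positive_operator :: "('a::banach_lattice \<Rightarrow> 'b::banach_lattice) \<Rightarrow> bool" where
  "positive_operator T \<longleftrightarrow> linear T \<and> (\<forall>x\<ge>0. 0 \<le> T x)"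

end

theory Submission
  imports Defs
begin

text \<open>
  Since \<open>\<bar>S x\<bar> \<le> T \<bar>x\<bar>\<close>, it suffices that the moduli of an almost limited weakly null sequence
  again form such a sequence.  Weak nullity is the assumption on the lattice operations.  For the
  other half, let \<open>(f\<^sub>n)\<close> be disjoint and weak* null.  For each \<open>n\<close> and \<open>x \<in> A\<close> there is a
  functional \<open>g\<close> with \<open>\<bar>g\<bar> \<le> \<bar>f\<^sub>n\<bar>\<close> and \<open>g x = \<bar>f\<^sub>n\<bar> \<bar>x\<bar>\<close>.  Taking as \<open>x\<close> a bad point for \<open>f\<^sub>n\<close>,
  one gets a disjoint sequence \<open>(g\<^sub>n)\<close> that is weak* null by property (d), so \<open>g\<^sub>n\<close> tends to
  zero uniformly on \<open>A\<close>, and therefore \<open>f\<^sub>n\<close> does so on \<open>{\<bar>x\<bar> | x \<in> A}\<close>.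
\<close>

section \<open>Banach lattices and their duals\<close>

lemma pprt_diff_pprt_uminus: "pprt x - pprt (- x) = (x :: 'a::lattice_ab_group_add)"
  by (metis diff_minus_eq_add pprt_neg prts)

lemma pprt_add_pprt_uminus: "pprt x + pprt (- x) = \<bar>x :: 'a::lattice_ab_group_add_abs\<bar>"
  by (metis abs_prts diff_minus_eq_add minus_minus pprt_neg)

text \<open>Translating by \<open>pprt x\<close> turns the infimum into \<open>inf 0 (- x)\<close>,
  which is \<open>- pprt x\<close>. This disjointness later lets a functional keep its value on one
  part of \<open>x\<close> and vanish on the other.\<close>

lemma inf_pprt_pprt_uminus: "inf (pprt x) (pprt (- x)) = (0 :: 'a::lattice_ab_group_add)"
proof -
  have "pprt (- x) = pprt x - x"
    using pprt_diff_pprt_uminus[of x] by (simp add: algebra_simps)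
  then have "inf (pprt x) (pprt (- x)) = pprt x + inf 0 (- x)"
    by (simp add: add_inf_distrib_left)
  also have "inf 0 (- x) = - pprt x"
    by (simp add: pprt_def neg_sup_eq_inf inf_commute)
  finally show ?thesis
    by simp
qed

lemma norm_abs [simp]: "norm \<bar>x\<bar> = norm (x :: 'a::banach_lattice)"
  by (intro antisym norm_mono_abs) simp_all

lemma dual_apply_nonneg:
  "0 \<le> blinfun_apply f x" if "dual_le 0 f" "0 \<le> x"
  using that by (simp add: dual_le_def)

lemma dual_le_abs:
  shows "dual_le f (dual_abs f)" "dual_le (- f) (dual_abs f)"
  using dual_sup[of f "- f"] by (auto simp: dual_abs_def is_dual_sup_def)

lemma dual_abs_least: "dual_le f k \<Longrightarrow> dual_le (- f) k \<Longrightarrow> dual_le (dual_abs f) k"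
  using dual_sup[of f "- f"] by (auto simp: dual_abs_def is_dual_sup_def)

lemma dual_abs_nonneg: "dual_le 0 (dual_abs f)"
  unfolding dual_le_def
proof (intro allI impI)
  fix x :: 'a assume "0 \<le> x"
  then show "blinfun_apply 0 x \<le> blinfun_apply (dual_abs f) x"
    using dual_le_abs[of f] by (fastforce simp: dual_le_def blinfun.minus_left)
qed

text \<open>On the cone this is the hypothesis; in general \<open>x\<close> is split into its
  positive and negative parts, whose sum is the modulus.\<close>

lemma abs_dual_apply_le:
  assumes "dual_le g k" "dual_le (- g) k"
  shows "\<bar>blinfun_apply g x\<bar> \<le> blinfun_apply k \<bar>x\<bar>"
proof -
  have pos: "\<bar>blinfun_apply g u\<bar> \<le> blinfun_apply k u" if "0 \<le> u" for u
    using assms that by (fastforce simp: dual_le_def blinfun.minus_left)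
  have "blinfun_apply g x = blinfun_apply g (pprt x) - blinfun_apply g (pprt (- x))"
    by (metis blinfun.diff_right pprt_diff_pprt_uminus)
  moreover have "blinfun_apply k \<bar>x\<bar> = blinfun_apply k (pprt x) + blinfun_apply k (pprt (- x))"
    by (metis blinfun.add_right pprt_add_pprt_uminus)
  ultimately show ?thesis
    using pos[OF zero_le_pprt[of x]] pos[OF zero_le_pprt[of "- x"]] by linarith
qed

text \<open>The modulus of each \<open>g n\<close> lies below that of \<open>f n\<close>, so the
  pairwise infima are squeezed to 0.\<close>

lemma dual_disjoint_seq_dominated:
  assumes f: "dual_disjoint_seq f"
    and g: "\<And>n. dual_le (g n) (dual_abs (f n))" "\<And>n. dual_le (- g n) (dual_abs (f n))"
  shows "dual_disjoint_seq g"
  unfolding dual_disjoint_seq_def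
proof (intro allI impI)
  fix n m :: nat assume "n \<noteq> m"
  then have "dual_inf (dual_abs (f n)) (dual_abs (f m)) = 0"
    using f by (simp add: dual_disjoint_seq_def)
  moreover have "dual_le (dual_abs (g i)) (dual_abs (f i))" for i
    using g by (intro dual_abs_least)
  ultimately have "dual_le (dual_inf (dual_abs (g n)) (dual_abs (g m))) 0"
    by (metis dual_lattice.inf_mono)
  moreover have "dual_le 0 (dual_inf (dual_abs (g n)) (dual_abs (g m)))"
    by (intro dual_lattice.inf_greatest dual_abs_nonneg)
  ultimately show "dual_inf (dual_abs (g n)) (dual_abs (g m)) = 0"
    by (rule dual_le_antisym)
qed

lemma weak_star_null_dominated:
  assumes "weak_star_null k" "\<And>n. dual_le (g n) (k n)" "\<And>n. dual_le (- g n) (k n)"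
  shows "weak_star_null g"
  unfolding weak_star_null_def
proof
  fix x
  have "(\<lambda>n. blinfun_apply (k n) \<bar>x\<bar>) \<longlonglongrightarrow> 0"
    using assms(1) by (simp add: weak_star_null_def)
  then show "(\<lambda>n. blinfun_apply (g n) x) \<longlonglongrightarrow> 0"
    by (rule Lim_null_comparison[rotated]) (simp add: abs_dual_apply_le assms(2,3))
qed

section \<open>Functionals attaining the modulus\<close>

text \<open>Kantorovich extension: every element is a difference of positive ones, so additivity and
  positive homogeneity determine a linear functional. The bounds 0 and \<open>\<phi>\<close> make it
  continuous.\<close>

lemma dual_extend_from_cone:
  fixes p :: "'a::banach_lattice \<Rightarrow> real" and \<phi> :: "'a dual"
  assumes add: "\<And>x y. 0 \<le> x \<Longrightarrow> 0 \<le> y \<Longrightarrow> p (x + y) = p x + p y"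
    and scale: "\<And>c x. 0 \<le> c \<Longrightarrow> 0 \<le> x \<Longrightarrow> p (c *\<^sub>R x) = c * p x"
    and bounds: "\<And>x. 0 \<le> x \<Longrightarrow> 0 \<le> p x" "\<And>x. 0 \<le> x \<Longrightarrow> p x \<le> blinfun_apply \<phi> x"
  obtains g :: "'a dual" where "\<And>x. 0 \<le> x \<Longrightarrow> blinfun_apply g x = p x"
proof
  define g where "g x = p (pprt x) - p (pprt (- x))" for x
  have p0: "p 0 = 0"
    using add[of 0 0] by simp
  \<comment> \<open>Independence of the decomposition: cross-adding two representations of
    \<open>u - v\<close> leaves sums of positive elements, where \<open>p\<close> is
    additive.\<close>
  have g_diff: "g (u - v) = p u - p v" if "0 \<le> u" "0 \<le> v" for u v
  proof -
    have "u + pprt (- (u - v)) = pprt (u - v) + v"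
      using pprt_diff_pprt_uminus[of "u - v"] by (simp add: algebra_simps)
    then have "p u + p (pprt (- (u - v))) = p (pprt (u - v)) + p v"
      using add that zero_le_pprt by metis
    then show ?thesis
      by (simp add: g_def)
  qed
  have g_add: "g (x + y) = g x + g y" for x y
  proof -
    have "x + y = (pprt x + pprt y) - (pprt (- x) + pprt (- y))"
      by (metis add_diff_add pprt_diff_pprt_uminus)
    then have "g (x + y) = p (pprt x + pprt y) - p (pprt (- x) + pprt (- y))"
      using g_diff by (metis add_nonneg_nonneg zero_le_pprt)
    then show ?thesis
      by (simp add: add g_def)
  qed
  have g_minus: "g (- x) = - g x" for x
    by (simp add: g_def)
  have g_scale_nonneg: "g (c *\<^sub>R x) = c * g x" if "0 \<le> c" for c x
  proof -
    have "c *\<^sub>R x = c *\<^sub>R pprt x - c *\<^sub>R pprt (- x)"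
      by (metis pprt_diff_pprt_uminus scaleR_diff_right)
    then have "g (c *\<^sub>R x) = p (c *\<^sub>R pprt x) - p (c *\<^sub>R pprt (- x))"
      using g_diff that by (metis scaleR_nonneg_nonneg zero_le_pprt)
    then show ?thesis
      using that by (simp add: scale g_def right_diff_distrib)
  qed
  have g_scale: "g (c *\<^sub>R x) = c * g x" for c x
  proof (cases "0 \<le> c")
    case False
    then show ?thesis
      using g_scale_nonneg[of "- c" x] g_minus[of "c *\<^sub>R x"] by simp
  qed (rule g_scale_nonneg)
  have g_bound: "norm (g x) \<le> norm x * norm \<phi>" for x
  proof -
    have "\<bar>g x\<bar> \<le> p (pprt x) + p (pprt (- x))"
      using bounds(1)[of "pprt x"] bounds(1)[of "pprt (- x)"] by (simp add: g_def)
    also have "\<dots> = p \<bar>x\<bar>"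
      by (metis add pprt_add_pprt_uminus zero_le_pprt)
    also have "\<dots> \<le> blinfun_apply \<phi> \<bar>x\<bar>"
      by (simp add: bounds)
    also have "\<dots> \<le> norm (blinfun_apply \<phi> \<bar>x\<bar>)"
      by simp
    also have "\<dots> \<le> norm \<phi> * norm x"
      using norm_blinfun[of \<phi> "\<bar>x\<bar>"] by simp
    finally show ?thesis
      by (simp add: mult.commute)
  qed
  have "bounded_linear g"
    by (rule bounded_linear_intro[OF g_add _ g_bound]) (simp add: g_scale)
  moreover have "g x = p x" if "0 \<le> x" for x
    using g_diff[of x 0] that p0 by simp
  ultimately show "blinfun_apply (Blinfun g) x = p x" if "0 \<le> x" for x
    using that by (simp add: bounded_linear_Blinfun_apply)
qed

text \<open>
  \<open>\<psi>\<close> is the component of \<open>\<phi>\<close> carried by the principal ideal generated by \<open>u\<close>: on the positive cone,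
  \<open>\<psi> x\<close> is the supremum of \<open>\<phi>\<close> over the elements of that ideal lying between \<open>0\<close> and \<open>x\<close>.
\<close>

lemma dual_component:
  fixes u :: "'a::banach_lattice" and \<phi> :: "'a dual"
  assumes \<phi>: "dual_le 0 \<phi>" and u: "0 \<le> u"
  obtains \<psi> where "dual_le 0 \<psi>" "dual_le \<psi> \<phi>" "blinfun_apply \<psi> u = blinfun_apply \<phi> u"
    "\<And>v. 0 \<le> v \<Longrightarrow> inf u v = 0 \<Longrightarrow> blinfun_apply \<psi> v = 0"
proof -
  define I where "I x = {z. 0 \<le> z \<and> z \<le> x \<and> (\<exists>t\<ge>0. z \<le> t *\<^sub>R u)}" for x
  define p where "p x = (SUP z\<in>I x. blinfun_apply \<phi> z)" for x
  have mono: "blinfun_apply \<phi> y \<le> blinfun_apply \<phi> x" if "y \<le> x" for x y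
    using dual_apply_nonneg[OF \<phi>, of "x - y"] that by (simp add: blinfun.diff_right)
  have bdd: "bdd_above (blinfun_apply \<phi> ` I x)" for x
    by (intro bdd_aboveI2[where M = "blinfun_apply \<phi> x"]) (simp add: I_def mono)
  have zero_I: "0 \<in> I x" if "0 \<le> x" for x
    using that by (auto simp: I_def)
  have upper: "blinfun_apply \<phi> z \<le> p x" if "z \<in> I x" for x z
    unfolding p_def using that by (intro cSUP_upper bdd)
  have least: "p x \<le> c" if "0 \<le> x" "\<And>z. z \<in> I x \<Longrightarrow> blinfun_apply \<phi> z \<le> c" for x c
    unfolding p_def using that zero_I by (intro cSUP_least) auto
  have p_nonneg: "0 \<le> p x" if "0 \<le> x" for x
    using upper[OF zero_I[OF that]] by simp
  have p_le: "p x \<le> blinfun_apply \<phi> x" if "0 \<le> x" for x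
    using that by (intro least mono) (auto simp: I_def)
  have I_add: "y + z \<in> I (x + x')" if yz: "y \<in> I x" "z \<in> I x'" for x x' y z
  proof -
    obtain s t where "0 \<le> s" "y \<le> s *\<^sub>R u" "0 \<le> t" "z \<le> t *\<^sub>R u"
      using yz by (auto simp: I_def)
    then have "0 \<le> s + t" "y + z \<le> (s + t) *\<^sub>R u"
      by (simp_all add: scaleR_add_left add_mono)
    then show ?thesis
      using yz by (auto simp: I_def intro: add_mono)
  qed
  have I_scale: "c *\<^sub>R z \<in> I (c *\<^sub>R x)" if "0 \<le> c" and z: "z \<in> I x" for c x z
  proof -
    obtain t where "0 \<le> t" "z \<le> t *\<^sub>R u"
      using z by (auto simp: I_def)
    then have "0 \<le> c * t" "c *\<^sub>R z \<le> (c * t) *\<^sub>R u"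
      using that scaleR_left_mono[of z "t *\<^sub>R u" c] by simp_all
    then show ?thesis
      using that by (auto simp: I_def intro: scaleR_left_mono scaleR_nonneg_nonneg)
  qed
  have p_add: "p (x + y) = p x + p y" if xy: "0 \<le> x" "0 \<le> y" for x y
  proof (rule order_antisym)
    show "p (x + y) \<le> p x + p y"
    proof (rule least)
      fix z assume z: "z \<in> I (x + y)"
      then obtain a b where ab: "z = a + b" "0 \<le> a" "a \<le> x" "0 \<le> b" "b \<le> y"
        using riesz_decomposition[OF xy, of z] by (auto simp: I_def)
      \<comment> \<open>Being below \<open>z\<close>, each Riesz summand inherits the bound by a
        multiple of \<open>u\<close>.\<close>
      then have "a \<le> z" "b \<le> z"
        by simp_all
      then have "a \<in> I x" "b \<in> I y"
        using z ab unfolding I_def by (blast intro: order_trans)+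
      then show "blinfun_apply \<phi> z \<le> p x + p y"
        by (simp add: ab(1) blinfun.add_right add_mono upper)
    qed (use xy in simp)
    have "p x \<le> p (x + y) - p y"
    proof (rule least[OF xy(1)])
      fix a assume a: "a \<in> I x"
      have "p y \<le> p (x + y) - blinfun_apply \<phi> a"
      proof (rule least[OF xy(2)])
        fix b assume "b \<in> I y"
        then show "blinfun_apply \<phi> b \<le> p (x + y) - blinfun_apply \<phi> a"
          using upper[OF I_add[OF a, of b y]] by (simp add: blinfun.add_right)
      qed
      then show "blinfun_apply \<phi> a \<le> p (x + y) - p y"
        by simp
    qed
    then show "p x + p y \<le> p (x + y)"
      by simp
  qed
  have p_scale_ge: "c * p x \<le> p (c *\<^sub>R x)" if "0 \<le> x" "0 < c" for c x
  proof -
    have "p x \<le> p (c *\<^sub>R x) / c"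
    proof (rule least[OF that(1)])
      fix z assume "z \<in> I x"
      then show "blinfun_apply \<phi> z \<le> p (c *\<^sub>R x) / c"
        using upper[OF I_scale[of c z x]] that
        by (simp add: blinfun.scaleR_right field_simps)
    qed
    then show ?thesis
      using that by (simp add: field_simps)
  qed
  have p_scale: "p (c *\<^sub>R x) = c * p x" if "0 \<le> c" "0 \<le> x" for c x
  proof (cases "c = 0")
    case True
    then show ?thesis
      using p_add[of 0 0] by simp
  next
    case False
    then have c: "0 < c"
      using that by simp
    \<comment> \<open>The reverse inequality is \<open>p_scale_ge\<close> for the scalar
      \<open>inverse c\<close> at the point \<open>c *\<^sub>R x\<close>.\<close>
    have "inverse c * p (c *\<^sub>R x) \<le> p (inverse c *\<^sub>R c *\<^sub>R x)"
      using c that by (intro p_scale_ge scaleR_nonneg_nonneg) auto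
    then have "p (c *\<^sub>R x) \<le> c * p x"
      using c by (simp add: field_simps)
    then show ?thesis
      using p_scale_ge[OF that(2) c] by simp
  qed
  obtain \<psi> :: "'a dual" where \<psi>: "\<And>x. 0 \<le> x \<Longrightarrow> blinfun_apply \<psi> x = p x"
    by (rule dual_extend_from_cone[of p \<phi>]) (use p_add p_scale p_nonneg p_le in blast)+
  show thesis
  proof
    show "dual_le 0 \<psi>" "dual_le \<psi> \<phi>"
      by (simp_all add: dual_le_def \<psi> p_nonneg p_le)
    \<comment> \<open>With \<open>t = 1\<close>, \<open>u\<close> itself competes in the supremum,
      so the upper bound \<open>\<phi>\<close> is attained there.\<close>
    have "u \<in> I u"
      using u by (auto simp: I_def intro: exI[of _ 1])
    then show "blinfun_apply \<psi> u = blinfun_apply \<phi> u"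
      using upper[of u u] p_le[OF u] u by (simp add: \<psi>)
    fix v assume v: "0 \<le> v" "inf u v = 0"
    have "z \<le> 0" if zI: "z \<in> I v" for z
    proof -
      obtain t where t: "0 \<le> t" "z \<le> t *\<^sub>R u" and z: "0 \<le> z" "z \<le> v"
        using zI by (auto simp: I_def)
      \<comment> \<open>The maximum with 1 makes \<open>s\<close> invertible and lets
        \<open>inverse s\<close> only shrink \<open>z\<close>. The scaled element is then below both
        \<open>u\<close> and \<open>v\<close>, hence below their infimum 0.\<close>
      define s where "s = max 1 t"
      have s: "1 \<le> s" "t \<le> s"
        by (simp_all add: s_def)
      have "z \<le> s *\<^sub>R u"
        using t(2) scaleR_right_mono[OF s(2) u] by simp
      then have "inverse s *\<^sub>R z \<le> inverse s *\<^sub>R s *\<^sub>R u"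
        using s by (intro scaleR_left_mono) auto
      then have "inverse s *\<^sub>R z \<le> u"
        using s by simp
      moreover have "inverse s *\<^sub>R z \<le> 1 *\<^sub>R z"
        using s z by (intro scaleR_right_mono) (auto simp: field_simps)
      then have "inverse s *\<^sub>R z \<le> v"
        using z(2) by simp
      ultimately have "inverse s *\<^sub>R z \<le> 0"
        using v(2) by (metis inf_greatest)
      then have "s *\<^sub>R inverse s *\<^sub>R z \<le> s *\<^sub>R 0"
        using s by (intro scaleR_left_mono) auto
      then show ?thesis
        using s by simp
    qed
    then have "p v \<le> 0"
      using mono[of _ 0] by (intro least v(1)) simp
    then show "blinfun_apply \<psi> v = 0"
      using p_nonneg[OF v(1)] v(1) by (simp add: \<psi>)
  qed
qed

text \<open>Let \<open>\<psi>\<close> be the component of \<open>\<phi>\<close> carried by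
  \<open>pprt x\<close>. Then \<open>\<psi> + \<psi> - \<phi>\<close> agrees with
  \<open>\<phi>\<close> on \<open>pprt x\<close> and with \<open>- \<phi>\<close> on
  \<open>pprt (- x)\<close>; it lies between \<open>- \<phi>\<close> and \<open>\<phi>\<close> since
  \<open>\<psi>\<close> lies between 0 and \<open>\<phi>\<close>.\<close>

lemma dual_attains_abs:
  fixes x :: "'a::banach_lattice" and \<phi> :: "'a dual"
  assumes \<phi>: "dual_le 0 \<phi>"
  obtains g where "dual_le g \<phi>" "dual_le (- g) \<phi>" "blinfun_apply g x = blinfun_apply \<phi> \<bar>x\<bar>"
proof -
  obtain \<psi> where \<psi>: "dual_le 0 \<psi>" "dual_le \<psi> \<phi>"
    "blinfun_apply \<psi> (pprt x) = blinfun_apply \<phi> (pprt x)"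
    "blinfun_apply \<psi> (pprt (- x)) = 0"
    using dual_component[OF \<phi>, of "pprt x"] inf_pprt_pprt_uminus zero_le_pprt by metis
  have g: "blinfun_apply (\<psi> + \<psi> - \<phi>) y = 2 * blinfun_apply \<psi> y - blinfun_apply \<phi> y" for y
    by (simp add: blinfun.diff_left blinfun.add_left)
  show thesis
  proof
    show "dual_le (\<psi> + \<psi> - \<phi>) \<phi>" "dual_le (- (\<psi> + \<psi> - \<phi>)) \<phi>"
      using \<psi>(1,2) unfolding dual_le_def blinfun.minus_left g by auto
    have "blinfun_apply h x = blinfun_apply h (pprt x) - blinfun_apply h (pprt (- x))" for h :: "'a dual"
      by (metis blinfun.diff_right pprt_diff_pprt_uminus)
    moreover have "blinfun_apply \<phi> \<bar>x\<bar> = blinfun_apply \<phi> (pprt x) + blinfun_apply \<phi> (pprt (- x))"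
      by (metis blinfun.add_right pprt_add_pprt_uminus)
    ultimately show "blinfun_apply (\<psi> + \<psi> - \<phi>) x = blinfun_apply \<phi> \<bar>x\<bar>"
      using \<psi>(3,4) by (simp add: g)
  qed
qed

section \<open>Almost limited sets and domination\<close>

lemma almost_limited_abs_image:
  fixes A :: "'a::banach_lattice set"
  assumes d: "property_d TYPE('a)" and A: "almost_limited A"
  shows "almost_limited (abs ` A)"
  unfolding almost_limited_def
proof (intro conjI allI impI)
  show "bounded (abs ` A)"
    using A by (simp add: almost_limited_def bounded_iff)
  fix f :: "nat \<Rightarrow> 'a dual"
  assume f: "dual_disjoint_seq f \<and> weak_star_null f"
  show "uniform_limit (abs ` A) (\<lambda>n x. blinfun_apply (f n) x) (\<lambda>x. 0) sequentially"
  proof (rule uniform_limitI)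
    fix e :: real assume e: "0 < e"
    \<comment> \<open>The choice depends on the fixed \<open>e\<close>. At a bad point the chosen
      functional is itself at least \<open>e\<close>, which refutes the premise of the implication;
      without a bad point 0 serves.\<close>
    have "\<exists>g. dual_le g (dual_abs (f n)) \<and> dual_le (- g) (dual_abs (f n)) \<and>
      ((\<forall>x\<in>A. \<bar>blinfun_apply g x\<bar> < e) \<longrightarrow> (\<forall>x\<in>A. blinfun_apply (dual_abs (f n)) \<bar>x\<bar> < e))" for n
    proof (cases "\<forall>x\<in>A. blinfun_apply (dual_abs (f n)) \<bar>x\<bar> < e")
      case True
      then show ?thesis
        by (intro exI[of _ 0]) (simp add: dual_abs_nonneg)
    next
      case False
      then obtain x where "x \<in> A" "\<not> blinfun_apply (dual_abs (f n)) \<bar>x\<bar> < e"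
        by blast
      moreover obtain g where "dual_le g (dual_abs (f n))" "dual_le (- g) (dual_abs (f n))"
        "blinfun_apply g x = blinfun_apply (dual_abs (f n)) \<bar>x\<bar>"
        using dual_attains_abs[OF dual_abs_nonneg] .
      ultimately show ?thesis
        by (metis abs_ge_self order_le_less_trans)
    qed
    then obtain g where g: "\<And>n. dual_le (g n) (dual_abs (f n))"
      "\<And>n. dual_le (- g n) (dual_abs (f n))"
      "\<And>n. \<forall>x\<in>A. \<bar>blinfun_apply (g n) x\<bar> < e \<Longrightarrow>
        \<forall>x\<in>A. blinfun_apply (dual_abs (f n)) \<bar>x\<bar> < e"
      by metis
    \<comment> \<open>Property (d) enters here: \<open>g\<close> is dominated by the moduli, so it
      is their weak* nullity that passes to \<open>g\<close>.\<close>
    have "weak_star_null (\<lambda>n. dual_abs (f n))"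
      using d f by (simp add: property_d_def)
    then have "weak_star_null g"
      by (rule weak_star_null_dominated) (rule g)+
    moreover have "dual_disjoint_seq g"
      using f by (intro dual_disjoint_seq_dominated[OF _ g(1,2)]) simp
    ultimately have "uniform_limit A (\<lambda>n x. blinfun_apply (g n) x) (\<lambda>x. 0) sequentially"
      using A unfolding almost_limited_def by blast
    then have "\<forall>\<^sub>F n in sequentially. \<forall>x\<in>A. \<bar>blinfun_apply (g n) x\<bar> < e"
      by (auto dest: uniform_limitD[OF _ e])
    then show "\<forall>\<^sub>F n in sequentially. \<forall>x\<in>abs ` A. dist (blinfun_apply (f n) x) 0 < e"
    proof (rule eventually_mono)
      fix n assume "\<forall>x\<in>A. \<bar>blinfun_apply (g n) x\<bar> < e"
      then have "\<forall>x\<in>A. blinfun_apply (dual_abs (f n)) \<bar>x\<bar> < e"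
        by (rule g(3))
      moreover have "\<bar>blinfun_apply (f n) \<bar>x\<bar>\<bar> \<le> blinfun_apply (dual_abs (f n)) \<bar>x\<bar>" for x
        using abs_dual_apply_le[OF dual_le_abs, of "f n" "\<bar>x\<bar>"] by simp
      ultimately show "\<forall>x\<in>abs ` A. dist (blinfun_apply (f n) x) 0 < e"
        by (auto intro: order_le_less_trans)
    qed
  qed
qed

text \<open>Both \<open>x\<close> and \<open>- x\<close> lie below \<open>\<bar>x\<bar>\<close>, so
  positivity of \<open>S\<close> bounds the modulus of \<open>S x\<close> by
  \<open>S \<bar>x\<bar>\<close>, which is at most \<open>T \<bar>x\<bar>\<close>.\<close>

lemma dominated_operator_norm_le:
  fixes S T :: "'a::banach_lattice \<Rightarrow> 'b::banach_lattice"
  assumes S: "positive_operator S" and TS: "positive_operator (\<lambda>x. T x - S x)"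
  shows "norm (S x) \<le> norm (T \<bar>x\<bar>)"
proof (rule norm_mono_abs)
  have lin: "linear S" and pos: "\<And>y. 0 \<le> y \<Longrightarrow> 0 \<le> S y"
    using S by (auto simp: positive_operator_def)
  have nonneg: "0 \<le> \<bar>x\<bar> - x" "0 \<le> \<bar>x\<bar> - (- x)"
    unfolding le_diff_eq by (simp_all add: abs_ge_self abs_ge_minus_self del: diff_minus_eq_add)
  have "S x \<le> S \<bar>x\<bar>"
    using pos[OF nonneg(1)] unfolding linear_diff[OF lin] le_diff_eq by simp
  moreover have "- S x \<le> S \<bar>x\<bar>"
    using pos[OF nonneg(2)] unfolding linear_diff[OF lin] linear_neg[OF lin] le_diff_eq by simp
  ultimately have "\<bar>S x\<bar> \<le> S \<bar>x\<bar>"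
    by (rule abs_leI)
  also have "\<dots> \<le> T \<bar>x\<bar>"
    using TS by (simp add: positive_operator_def)
  also have "\<dots> \<le> \<bar>T \<bar>x\<bar>\<bar>"
    by (rule abs_ge_self)
  finally show "\<bar>S x\<bar> \<le> \<bar>T \<bar>x\<bar>\<bar>" .
qed

text \<open>This isolates the domination argument; property (d) enters only through the last
  hypothesis, which \<open>almost_limited_abs_image\<close> supplies.\<close>

lemma alcc_dominated:
  fixes S :: "'a::banach_lattice \<Rightarrow> 'b::banach" and T :: "'a \<Rightarrow> 'c::banach"
  assumes lin: "linear S" and T: "alcc T"
    and dom: "\<And>x. norm (S x) \<le> norm (T \<bar>x\<bar>)"
    and weak: "weakly_seq_cont_lattice_ops TYPE('a)"
    and abs: "\<And>A :: 'a set. almost_limited A \<Longrightarrow> almost_limited (abs ` A)"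
  shows "alcc S"
proof -
  have "bounded_linear T"
    using T by (simp add: alcc_def)
  then obtain K where K: "\<And>x. norm (T x) \<le> norm x * K"
    using bounded_linear.bounded by blast
  \<comment> \<open>Continuity of \<open>S\<close> has to be derived: the bound for \<open>T\<close>
    transfers because \<open>\<bar>x\<bar>\<close> and \<open>x\<close> have equal norm.\<close>
  have "norm (S x) \<le> norm x * K" for x
    using dom[of x] K[of "\<bar>x\<bar>"] by simp
  then have "bounded_linear S"
    by (intro bounded_linear_intro) (simp_all add: linear_add[OF lin] linear_scale[OF lin])
  moreover have "(\<lambda>n. norm (S (x n))) \<longlonglongrightarrow> 0"
    if x: "almost_limited (range x)" "weakly_null x" for x :: "nat \<Rightarrow> 'a"
  proof -
    have "almost_limited (range (\<lambda>n. \<bar>x n\<bar>))"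
      using abs[OF x(1)] by (simp add: image_image)
    moreover have "weakly_null (\<lambda>n. \<bar>x n\<bar>)"
      using weak x(2) by (simp add: weakly_seq_cont_lattice_ops_def)
    ultimately have "(\<lambda>n. norm (T \<bar>x n\<bar>)) \<longlonglongrightarrow> 0"
      using T by (simp add: alcc_def)
    then show ?thesis
      by (rule Lim_null_comparison[rotated]) (simp add: dom)
  qed
  ultimately show ?thesis
    by (simp add: alcc_def)
qed

theorem theorem3p13:
  fixes S T :: "'e::banach_lattice \<Rightarrow> 'f::banach_lattice"
  assumes "positive_operator S"
    and "positive_operator T"
    and "positive_operator (\<lambda>x. T x - S x)"
    and "alcc T"
    and "property_d TYPE('e)"
    and "weakly_seq_cont_lattice_ops TYPE('e)"
  shows "alcc S"
  by (rule alcc_dominated[OF _ assms(4) dominated_operator_norm_le[OF assms(1,3)] assms(6)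
        almost_limited_abs_image[OF assms(5)]])
    (use assms(1) in \<open>auto simp: positive_operator_def\<close>)

end
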